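(* For all $F,G\in L^2(\Omega)$ such that $E[\|DF\|_{\ell^2(\mathbb{N})}^2]<\infty$, $$\mathrm{Cov}(F,G)=E\left[\sum_{k=0}^\infty E[D_kG\mid\mathcal{F}_{k-1}]\,D_kF\right].$$
   Context: $\mathbb{N}=\{0,1,2,\ldots\}$. Let $(p_k)_{k\in\mathbb{N}}$ be a deterministic sequence in $(0,1)$ and $q_k=1-p_k$. Let $\Omega=\{-1,1\}^{\mathbb{N}}$ with its product $\sigma$-algebra, let $X_k:\Omega\to\{-1,1\}$ be the canonical projections, and let $\mathbb{P}$ be the product probability measure under which the $X_k$ are independent with $\mathbb{P}(X_k=1)=p_k$, $\mathbb{P}(X_k=-1)=q_k$. Set $\mathcal{F}_n=\sigma(X_0,\ldots,X_n)$ for $n\ge0$, $\mathcal{F}_{-1}=\{\emptyset,\Omega\}$. For $F:\Omega\to\mathbb{R}$, $D_kF(\omega)=\sqrt{p_kq_k}\,(F(\omega_+^k)-F(\omega_-^k))$, where $\omega_\pm^k$ is $\omega$ with its $k$-th coordinate replaced by $\pm1$, and $DF=(D_kF)_{k\in\mathbb{N}}$. $\mathrm{Cov}(F,G)=E[FG]-E[F]E[G]$. *)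

theory Defs
  imports "HOL-Probability.Probability"
begin

definition sign_measure :: "real \<Rightarrow> real measure" where
  "sign_measure r = point_measure {-1, 1} (\<lambda>x. ennreal (if x = 1 then r else 1 - r))"

text \<open>
  The space of this measure is \<open>\<Pi>\<^sub>E k\<in>UNIV. {-1, 1}\<close>, that is \<open>\<Omega> = {-1, 1}\<^sup>\<nat>\<close>;
  functions with values outside \<open>{-1, 1}\<close> are not points of it.
\<close>
definition walk_space :: "(nat \<Rightarrow> real) \<Rightarrow> (nat \<Rightarrow> real) measure" where
  "walk_space p = PiM UNIV (\<lambda>k. sign_measure (p k))"

definition coord :: "nat \<Rightarrow> (nat \<Rightarrow> real) \<Rightarrow> real" where
  "coord k \<omega> = \<omega> k"

text \<open>
  \<open>\<F>\<^sub>n = \<sigma>(X\<^sub>0, \<dots>, X\<^sub>n)\<close>. The index is an integer so that \<open>\<F>\<^sub>-\<^sub>1\<close>, which has no generators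
  and hence is the trivial \<open>\<sigma>\<close>-algebra, is covered. Only the \<open>\<sigma>\<close>-algebra of this
  measure is meaningful.
\<close>
definition filt :: "(nat \<Rightarrow> real) \<Rightarrow> int \<Rightarrow> (nat \<Rightarrow> real) measure" where
  "filt p n = sigma (space (walk_space p))
     {coord j -` A \<inter> space (walk_space p) | j A. int j \<le> n \<and> A \<subseteq> {-1, 1}}"

definition grad :: "(nat \<Rightarrow> real) \<Rightarrow> nat \<Rightarrow> ((nat \<Rightarrow> real) \<Rightarrow> real) \<Rightarrow> (nat \<Rightarrow> real) \<Rightarrow> real" where
  "grad p k F w = sqrt (p k * (1 - p k)) * (F (w(k := 1)) - F (w(k := -1)))"

text \<open>\<open>\<parallel>DF(\<omega>)\<parallel>\<^sup>2\<close> in \<open>\<ell>\<^sup>2(\<nat>)\<close>, with value \<open>\<infinity>\<close> if \<open>DF(\<omega>)\<close> is not square summable.\<close>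
definition grad_norm_sq :: "(nat \<Rightarrow> real) \<Rightarrow> ((nat \<Rightarrow> real) \<Rightarrow> real) \<Rightarrow> (nat \<Rightarrow> real) \<Rightarrow> ennreal" where
  "grad_norm_sq p F \<omega> = (\<Sum>k. ennreal ((grad p k F \<omega>)\<^sup>2))"

definition L2 :: "'a measure \<Rightarrow> ('a \<Rightarrow> real) set" where
  "L2 M = {F \<in> borel_measurable M. integrable M (\<lambda>\<omega>. (F \<omega>)\<^sup>2)}"

definition cov :: "'a measure \<Rightarrow> ('a \<Rightarrow> real) \<Rightarrow> ('a \<Rightarrow> real) \<Rightarrow> real" where
  "cov M F G = (LINT \<omega>|M. F \<omega> * G \<omega>) - (LINT \<omega>|M. F \<omega>) * (LINT \<omega>|M. G \<omega>)"

lemma space_walk_space: "space (walk_space p) = (\<Pi>\<^sub>E k\<in>UNIV. {-1, 1})"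
  by (simp add: walk_space_def space_PiM sign_measure_def space_point_measure)

lemma prob_space_sign_measure:
  assumes "0 < r" "r < 1"
  shows "prob_space (sign_measure r)"
proof (rule prob_spaceI)
  show "emeasure (sign_measure r) (space (sign_measure r)) = 1"
    using assms
    by (simp add: sign_measure_def space_point_measure emeasure_point_measure_finite
        flip: ennreal_plus)
qed

lemma prob_space_walk_space:
  assumes "\<And>k. 0 < p k \<and> p k < 1"
  shows "prob_space (walk_space p)"
  unfolding walk_space_def
  by (intro prob_space_PiM prob_space_sign_measure) (use assms in auto)

lemma subalgebra_filt: "subalgebra (walk_space p) (filt p n)"
proof -
  have "coord j -` A \<inter> space (walk_space p) \<in> sets (walk_space p)" if "A \<subseteq> {-1, 1}" for j A
  proof (rule measurable_sets)
    show "coord j \<in> walk_space p \<rightarrow>\<^sub>M sign_measure (p j)"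
      unfolding walk_space_def coord_def by (rule measurable_component_singleton) simp
    show "A \<in> sets (sign_measure (p j))"
      using that by (simp add: sign_measure_def sets_point_measure)
  qed
  then have gen: "{coord j -` A \<inter> space (walk_space p) | j A. int j \<le> n \<and> A \<subseteq> {-1, 1}}
      \<subseteq> sets (walk_space p)"
    by auto
  then have "sets (filt p n) \<subseteq> sets (walk_space p)"
    unfolding filt_def using sets.space_closed
    by (subst sets_measure_of) (blast, rule sets.sigma_sets_subset)
  then show ?thesis
    by (simp add: subalgebra_def filt_def space_measure_of_conv)
qed

lemma sets_filt_minus_1: "sets (filt p (-1)) = {{}, space (walk_space p)}"
proof -
  have "{coord j -` A \<inter> space (walk_space p) | j A. int j \<le> -1 \<and> A \<subseteq> {-1, 1}} = {}"
    by auto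
  then show ?thesis
    by (simp add: filt_def sigma_sets_empty_eq)
qed

end

theory Submission
  imports Defs
begin

text \<open>
  Put \<open>u\<^sub>k = E[D\<^sub>k G | \<F>\<^sub>k\<^sub>-\<^sub>1]\<close> and let \<open>Y\<^sub>k\<close> be the normalized \<open>k\<close>-th coordinate. Integrating out
  the \<open>k\<close>-th coordinate gives \<open>E[F Y\<^sub>k H] = E[D\<^sub>k F H]\<close> for \<open>\<F>\<^sub>k\<^sub>-\<^sub>1\<close>-measurable \<open>H\<close>, and hence
  \<open>E[G | \<F>\<^sub>k] = E[G | \<F>\<^sub>k\<^sub>-\<^sub>1] + Y\<^sub>k u\<^sub>k\<close>. Telescoping and integrating by parts once more,
  \<open>\<Sum>k<n. E[u\<^sub>k D\<^sub>k F] = E[F E[G | \<F>\<^sub>n\<^sub>-\<^sub>1]] - E[F] E[G]\<close>. The right-hand side tends to \<open>Cov(F, G)\<close>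
  because the functions of finitely many coordinates are dense in \<open>L\<^sup>2\<close>; the left-hand side
  converges absolutely because \<open>\<Sum>k. E[u\<^sub>k\<^sup>2] \<le> E[G\<^sup>2]\<close> by Bessel's inequality.
\<close>

subsection \<open>Density in \<open>L\<^sup>2\<close> along a generating filtration\<close>

lemma abs_mult_le_sum_squares: "\<bar>a * b\<bar> \<le> a\<^sup>2 + b\<^sup>2" for a b :: real
  using sum_squares_bound[of "\<bar>a\<bar>" "\<bar>b\<bar>"] mult_nonneg_nonneg[OF abs_ge_zero abs_ge_zero, of a b]
  unfolding abs_mult power2_abs by linarith

text \<open>AM-GM for \<open>c * \<bar>a\<bar>\<close> and \<open>e * \<bar>b\<bar>\<close>, divided
  by \<open>2 * c * e\<close>. The weights are fitted to the use below: a squared distance under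
  \<open>e\<^sup>2 / C\<close> and one of at most \<open>C\<close> then contribute at most
  \<open>e / 2\<close> each.\<close>

lemma weighted_young:
  fixes a b c e :: real
  assumes c: "0 < c" and e: "0 < e"
  shows "\<bar>a * b\<bar> \<le> c / (2 * e) * a\<^sup>2 + e / (2 * c) * b\<^sup>2"
proof -
  have "\<bar>a * b\<bar> = 2 * (c * \<bar>a\<bar>) * (e * \<bar>b\<bar>) / (2 * c * e)"
    using c e by (simp add: abs_mult)
  also have "\<dots> \<le> ((c * \<bar>a\<bar>)\<^sup>2 + (e * \<bar>b\<bar>)\<^sup>2) / (2 * c * e)"
    using c e by (intro divide_right_mono sum_squares_bound) auto
  also have "\<dots> = (c\<^sup>2 * a\<^sup>2) / (2 * c * e) + (e\<^sup>2 * b\<^sup>2) / (2 * c * e)"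
    by (simp only: power_mult_distrib power2_abs add_divide_distrib)
  also have "\<dots> = c / (2 * e) * a\<^sup>2 + e / (2 * c) * b\<^sup>2"
    using c e by (simp add: power2_eq_square)
  finally show ?thesis .
qed

lemma L2_borel_measurable: "f \<in> L2 M \<Longrightarrow> f \<in> borel_measurable M"
  by (simp add: L2_def)

lemma L2_integrable_square: "f \<in> L2 M \<Longrightarrow> integrable M (\<lambda>x. (f x)\<^sup>2)"
  by (simp add: L2_def)

lemma L2_integrable_mult:
  assumes "f \<in> L2 M" "g \<in> L2 M"
  shows "integrable M (\<lambda>x. f x * g x)"
proof (rule Bochner_Integration.integrable_bound)
  show "integrable M (\<lambda>x. (f x)\<^sup>2 + (g x)\<^sup>2)"
    using assms by (simp add: L2_def)
  show "(\<lambda>x. f x * g x) \<in> borel_measurable M"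
    using assms by (intro borel_measurable_times L2_borel_measurable)
  show "AE x in M. norm (f x * g x) \<le> norm ((f x)\<^sup>2 + (g x)\<^sup>2)"
    using abs_mult_le_sum_squares by simp
qed

lemma L2_cmult: "f \<in> L2 M \<Longrightarrow> (\<lambda>x. c * f x) \<in> L2 M"
  by (auto simp: L2_def power_mult_distrib)

lemma L2_add:
  assumes "f \<in> L2 M" "g \<in> L2 M"
  shows "(\<lambda>x. f x + g x) \<in> L2 M"
  using assms L2_integrable_mult[OF assms] by (auto simp: L2_def power2_sum mult.assoc)

lemma L2_diff:
  assumes "f \<in> L2 M" "g \<in> L2 M"
  shows "(\<lambda>x. f x - g x) \<in> L2 M"
  using L2_add[OF assms(1) L2_cmult[OF assms(2), of "-1"]] by simp

lemma L2_bounded_mult: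
  assumes "f \<in> L2 M" "g \<in> borel_measurable M" "\<And>x. x \<in> space M \<Longrightarrow> \<bar>g x\<bar> \<le> C"
  shows "(\<lambda>x. g x * f x) \<in> L2 M"
proof -
  note [measurable] = L2_borel_measurable[OF assms(1)] assms(2)
  have "integrable M (\<lambda>x. (g x * f x)\<^sup>2)"
  proof (rule Bochner_Integration.integrable_bound)
    show "integrable M (\<lambda>x. C\<^sup>2 * (f x)\<^sup>2)"
      using L2_integrable_square[OF assms(1)] by simp
    have "(g x)\<^sup>2 * (f x)\<^sup>2 \<le> C\<^sup>2 * (f x)\<^sup>2" if "x \<in> space M" for x
      using assms(3)[OF that] by (intro mult_right_mono) (auto simp: abs_le_square_iff[symmetric])
    then show "AE x in M. norm ((g x * f x)\<^sup>2) \<le> norm (C\<^sup>2 * (f x)\<^sup>2)"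
      by (simp add: power_mult_distrib)
  qed simp
  then show ?thesis by (simp add: L2_def)
qed

lemma (in finite_measure) L2_bounded:
  assumes "f \<in> borel_measurable M" "\<And>x. x \<in> space M \<Longrightarrow> \<bar>f x\<bar> \<le> C"
  shows "f \<in> L2 M"
  using L2_bounded_mult[of "\<lambda>_. 1" M f C] assms by (simp add: L2_def)

lemma (in finite_measure) L2_integrable:
  assumes "f \<in> L2 M"
  shows "integrable M f"
  using L2_integrable_mult[OF assms, of "\<lambda>_. 1"] by (simp add: L2_def)

text \<open>The difference of the two sides is the square of \<open>a - 2 * b + c\<close>.
  Integrated, this gives a triangle inequality with factor 2 for squared distances, so that no norms
  or square roots occur.\<close>

lemma square_diff_le: "(a - c)\<^sup>2 \<le> 2 * (a - b)\<^sup>2 + 2 * (b - c)\<^sup>2" for a b c :: real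
  using zero_le_power2[of "a - 2 * b + c"] by (simp add: power2_eq_square algebra_simps)

lemma L2_dist_triangle:
  assumes "f \<in> L2 M" "g \<in> L2 M" "h \<in> L2 M"
  shows "(\<integral>x. (f x - h x)\<^sup>2 \<partial>M) \<le> 2 * (\<integral>x. (f x - g x)\<^sup>2 \<partial>M) + 2 * (\<integral>x. (g x - h x)\<^sup>2 \<partial>M)"
proof -
  note int = L2_integrable_square[OF L2_diff]
  have "(\<integral>x. (f x - h x)\<^sup>2 \<partial>M) \<le> (\<integral>x. 2 * (f x - g x)\<^sup>2 + 2 * (g x - h x)\<^sup>2 \<partial>M)"
    using assms by (intro integral_mono Bochner_Integration.integrable_add integrable_mult_right int square_diff_le)
  also have "\<dots> = 2 * (\<integral>x. (f x - g x)\<^sup>2 \<partial>M) + 2 * (\<integral>x. (g x - h x)\<^sup>2 \<partial>M)"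
    using int[OF assms(1,2)] int[OF assms(2,3)] by simp
  finally show ?thesis .
qed

section \<open>The \<open>L2\<close> closure of the functions measurable at some finite
  stage\<close>

definition L2_approximable :: "'a measure \<Rightarrow> (nat \<Rightarrow> 'a measure) \<Rightarrow> ('a \<Rightarrow> real) \<Rightarrow> bool" where
  "L2_approximable M \<F> f \<longleftrightarrow> f \<in> L2 M \<and>
     (\<forall>e>0. \<exists>n. \<exists>h \<in> L2 M. h \<in> borel_measurable (\<F> n) \<and> (\<integral>x. (f x - h x)\<^sup>2 \<partial>M) < e)"

lemma L2_approximableI:
  assumes "f \<in> L2 M" "f \<in> borel_measurable (\<F> n)"
  shows "L2_approximable M \<F> f"
  using assms unfolding L2_approximable_def by (intro conjI allI impI exI bexI[of _ f]) auto

lemma L2_approximable_cmult: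
  assumes "L2_approximable M \<F> f"
  shows "L2_approximable M \<F> (\<lambda>x. c * f x)"
  unfolding L2_approximable_def
proof (intro conjI allI impI)
  show "(\<lambda>x. c * f x) \<in> L2 M"
    using assms by (simp add: L2_approximable_def L2_cmult)
  fix e :: real assume "0 < e"
  \<comment> \<open>Dividing by \<open>c\<^sup>2 + 1\<close> instead of \<open>c\<^sup>2\<close>
    covers \<open>c = 0\<close> without a case distinction.\<close>
  have c: "0 < c\<^sup>2 + 1"
    by (simp add: add_nonneg_pos)
  then have "0 < e / (c\<^sup>2 + 1)"
    using \<open>0 < e\<close> by simp
  then obtain n h where h: "h \<in> L2 M" "h \<in> borel_measurable (\<F> n)"
    "(\<integral>x. (f x - h x)\<^sup>2 \<partial>M) < e / (c\<^sup>2 + 1)"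
    using assms unfolding L2_approximable_def by blast
  have "(\<integral>x. (c * f x - c * h x)\<^sup>2 \<partial>M) = c\<^sup>2 * (\<integral>x. (f x - h x)\<^sup>2 \<partial>M)"
    unfolding right_diff_distrib[symmetric] power_mult_distrib by simp
  also have "\<dots> \<le> c\<^sup>2 * (e / (c\<^sup>2 + 1))"
    using h(3) by (intro mult_left_mono) auto
  also have "\<dots> < e"
    using \<open>0 < e\<close> c by (simp add: pos_divide_less_eq distrib_left mult.commute)
  finally show "\<exists>n. \<exists>h \<in> L2 M. h \<in> borel_measurable (\<F> n) \<and> (\<integral>x. (c * f x - h x)\<^sup>2 \<partial>M) < e"
    using h(1,2) by (intro exI[of _ n] bexI[of _ "\<lambda>x. c * h x"]) (auto intro: L2_cmult)
qed

text \<open>Dominated convergence for the squared errors turns pointwise into \<open>L2\<close>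
  convergence, and a closure is closed under \<open>L2\<close> limits. The dominating function
  bounds the error itself, which suits each use below.\<close>

lemma L2_approximable_lim:
  assumes s: "\<And>i. L2_approximable M \<F> (s i)" and f: "f \<in> L2 M" and w: "integrable M w"
    and bound: "\<And>i x. x \<in> space M \<Longrightarrow> (f x - s i x)\<^sup>2 \<le> w x"
    and lim: "\<And>x. x \<in> space M \<Longrightarrow> (\<lambda>i. s i x) \<longlonglongrightarrow> f x"
  shows "L2_approximable M \<F> f"
  unfolding L2_approximable_def
proof (intro conjI allI impI f)
  fix e :: real assume "0 < e"
  have s_L2: "s i \<in> L2 M" for i
    using s by (simp add: L2_approximable_def)
  note [measurable] = L2_borel_measurable[OF f] L2_borel_measurable[OF s_L2]
  have "(\<lambda>i. \<integral>x. (f x - s i x)\<^sup>2 \<partial>M) \<longlonglongrightarrow> (\<integral>x. 0 \<partial>M)"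
  proof (rule integral_dominated_convergence[OF _ _ w])
    have "(\<lambda>i. (f x - s i x)\<^sup>2) \<longlonglongrightarrow> (f x - f x)\<^sup>2" if "x \<in> space M" for x
      by (intro tendsto_intros lim that)
    then show "AE x in M. (\<lambda>i. (f x - s i x)\<^sup>2) \<longlonglongrightarrow> 0"
      by simp
    show "AE x in M. norm ((f x - s i x)\<^sup>2) \<le> w x" for i
      using bound by simp
  qed simp_all
  \<comment> \<open>Two errors below \<open>e / 4\<close>, each doubled by
    \<open>L2_dist_triangle\<close>, add up to less than \<open>e\<close>.\<close>
  then have "\<forall>\<^sub>F i in sequentially. (\<integral>x. (f x - s i x)\<^sup>2 \<partial>M) < e / 4"
    using \<open>0 < e\<close> by (intro order_tendstoD) auto
  then obtain i where i: "(\<integral>x. (f x - s i x)\<^sup>2 \<partial>M) < e / 4"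
    by (auto simp: eventually_sequentially)
  obtain n h where h: "h \<in> L2 M" "h \<in> borel_measurable (\<F> n)" "(\<integral>x. (s i x - h x)\<^sup>2 \<partial>M) < e / 4"
    using s[of i] \<open>0 < e\<close> unfolding L2_approximable_def by (meson divide_pos_pos zero_less_numeral)
  have "(\<integral>x. (f x - h x)\<^sup>2 \<partial>M) < e"
    using L2_dist_triangle[OF f s_L2[of i] h(1)] i h(3) by simp
  then show "\<exists>n. \<exists>h \<in> L2 M. h \<in> borel_measurable (\<F> n) \<and> (\<integral>x. (f x - h x)\<^sup>2 \<partial>M) < e"
    using h by blast
qed

text \<open>The union of the stages is in general only an algebra, so generation is stated through
  \<open>sigma_sets\<close>; this is the input of the pi-lambda argument below.\<close>

locale generating_filtration = finite_measure M for M :: "'a measure" +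
  fixes \<F> :: "nat \<Rightarrow> 'a measure"
  assumes subalgebra_filtration: "\<And>n. subalgebra M (\<F> n)"
    and filtration_mono: "\<And>m n. m \<le> n \<Longrightarrow> sets (\<F> m) \<subseteq> sets (\<F> n)"
    and filtration_generates: "sets M = sigma_sets (space M) (\<Union>n. sets (\<F> n))"
begin

lemma measurable_filtration_mono:
  assumes "m \<le> n" "h \<in> borel_measurable (\<F> m)"
  shows "h \<in> borel_measurable (\<F> n)"
  using measurable_mono[of borel borel "\<F> m" "\<F> n"] filtration_mono[OF assms(1)]
    subalgebra_filtration assms(2) by (auto simp: subalgebra_def)

lemma L2_approximable_add:
  assumes f: "L2_approximable M \<F> f" and g: "L2_approximable M \<F> g"
  shows "L2_approximable M \<F> (\<lambda>x. f x + g x)"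
  unfolding L2_approximable_def
proof (intro conjI allI impI)
  have L2: "f \<in> L2 M" "g \<in> L2 M"
    using f g by (auto simp: L2_approximable_def)
  then show "(\<lambda>x. f x + g x) \<in> L2 M"
    by (rule L2_add)
  fix e :: real assume "0 < e"
  then have e: "0 < e / 4" by simp
  obtain m h where h: "h \<in> L2 M" "h \<in> borel_measurable (\<F> m)" "(\<integral>x. (f x - h x)\<^sup>2 \<partial>M) < e / 4"
    using f e unfolding L2_approximable_def by blast
  obtain n k where k: "k \<in> L2 M" "k \<in> borel_measurable (\<F> n)" "(\<integral>x. (g x - k x)\<^sup>2 \<partial>M) < e / 4"
    using g e unfolding L2_approximable_def by blast
  \<comment> \<open>The intermediate point \<open>h + g\<close> replaces one summand at a time, so
    each of the two errors is that of a single approximation.\<close>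
  have "(\<integral>x. ((f x + g x) - (h x + k x))\<^sup>2 \<partial>M)
      \<le> 2 * (\<integral>x. ((f x + g x) - (h x + g x))\<^sup>2 \<partial>M) + 2 * (\<integral>x. ((h x + g x) - (h x + k x))\<^sup>2 \<partial>M)"
    by (intro L2_dist_triangle L2_add L2 h k)
  also have "\<dots> < e"
    using h(3) k(3) by simp
  finally have "(\<integral>x. ((f x + g x) - (h x + k x))\<^sup>2 \<partial>M) < e" .
  moreover have "(\<lambda>x. h x + k x) \<in> borel_measurable (\<F> (max m n))"
    using measurable_filtration_mono[OF _ h(2)] measurable_filtration_mono[OF _ k(2)]
    by (intro borel_measurable_add) auto
  ultimately show "\<exists>n. \<exists>h \<in> L2 M. h \<in> borel_measurable (\<F> n) \<and> (\<integral>x. (f x + g x - h x)\<^sup>2 \<partial>M) < e"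
    using L2_add[OF h(1) k(1)] by blast
qed

lemma L2_approximable_const: "L2_approximable M \<F> (\<lambda>_. c)"
  by (rule L2_approximableI[where n = 0]) (auto simp: L2_def)

lemma L2_approximable_sum:
  assumes "finite I" "\<And>i. i \<in> I \<Longrightarrow> L2_approximable M \<F> (f i)"
  shows "L2_approximable M \<F> (\<lambda>x. \<Sum>i\<in>I. f i x)"
  using assms by (induction I) (auto intro: L2_approximable_const L2_approximable_add)

lemma L2_indicator: "A \<in> sets M \<Longrightarrow> (indicator A :: 'a \<Rightarrow> real) \<in> L2 M"
  by (rule L2_bounded[where C = 1]) (auto simp: indicator_def)

lemma L2_approximable_cong:
  assumes "L2_approximable M \<F> f" "\<And>x. x \<in> space M \<Longrightarrow> f x = g x"
  shows "L2_approximable M \<F> g"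
proof -
  have "integrable M (\<lambda>x. (f x)\<^sup>2) = integrable M (\<lambda>x. (g x)\<^sup>2)"
    by (intro Bochner_Integration.integrable_cong) (simp_all add: assms(2))
  then have "g \<in> L2 M"
    using assms measurable_cong[of M f g borel] by (simp add: L2_approximable_def L2_def)
  \<comment> \<open>The constant sequence \<open>f\<close> converges to \<open>g\<close> on the
    space, with error 0.\<close>
  with assms(1) show ?thesis
    by (rule L2_approximable_lim[where s = "\<lambda>_. f" and w = "\<lambda>_. 0"]) (simp_all add: assms(2))
qed

text \<open>Dynkin's pi-lambda theorem: the stages increase, so their union is stable under
  intersection, and the sets with approximable indicator contain it and are closed under complements
  and countable disjoint unions.\<close>

lemma L2_approximable_indicator:
  assumes "A \<in> sets M"
  shows "L2_approximable M \<F> (indicator A)"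
proof -
  have "Int_stable (\<Union>n. sets (\<F> n))"
  proof (rule Int_stableI)
    fix a b assume "a \<in> (\<Union>n. sets (\<F> n))" "b \<in> (\<Union>n. sets (\<F> n))"
    then obtain m n where "a \<in> sets (\<F> m)" "b \<in> sets (\<F> n)" by blast
    then have "a \<in> sets (\<F> (max m n))" "b \<in> sets (\<F> (max m n))"
      using filtration_mono[of m "max m n"] filtration_mono[of n "max m n"] by auto
    then show "a \<inter> b \<in> (\<Union>n. sets (\<F> n))" by blast
  qed
  moreover have "(\<Union>n. sets (\<F> n)) \<subseteq> Pow (space M)"
    using subalgebra_filtration sets.space_closed by (fastforce simp: subalgebra_def)
  moreover have "A \<in> sigma_sets (space M) (\<Union>n. sets (\<F> n))"
    using assms filtration_generates by simp
  ultimately show ?thesis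
  proof (induction rule: sigma_sets_induct_disjoint)
    case (basic A)
    then obtain n where "A \<in> sets (\<F> n)" by blast
    moreover then have "A \<in> sets M"
      using subalgebra_filtration by (auto simp: subalgebra_def)
    ultimately show ?case
      by (intro L2_approximableI[where n = n] L2_indicator) auto
  next
    case empty
    show ?case using L2_approximable_const[of 0] by simp
  next
    case (compl A)
    have "L2_approximable M \<F> (\<lambda>x. 1 + (-1) * indicator A x)"
      by (intro L2_approximable_add L2_approximable_const L2_approximable_cmult compl)
    then show ?case
      by (rule L2_approximable_cong) (simp add: indicator_def)
  next
    case (union A)
    have A: "A i \<in> sets M" for i
      using union(2) filtration_generates by auto
    show ?case
    proof (rule L2_approximable_lim[where w = "\<lambda>_. 1" and s = "\<lambda>n x. \<Sum>i<n. indicator (A i) x"])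
      show "L2_approximable M \<F> (\<lambda>x. \<Sum>i<n. indicator (A i) x)" for n
        by (intro L2_approximable_sum union) simp
      show "indicator (\<Union> (range A)) \<in> L2 M"
        using A by (intro L2_indicator) auto
      \<comment> \<open>By disjointness a partial sum is again an indicator, so the squared error is
        at most 1 and constants dominate on a finite measure space.\<close>
      have partial: "(\<Sum>i<n. indicator (A i) x) = (indicator (\<Union>i<n. A i) x :: real)" for n x
        using union(1) by (subst indicator_UN_disjoint) (auto intro: disjoint_family_on_mono)
      show "(indicator (\<Union> (range A)) x - (\<Sum>i<n. indicator (A i) x))\<^sup>2 \<le> (1::real)" for n x
        unfolding partial by (simp add: indicator_def)
      show "(\<lambda>n. \<Sum>i<n. indicator (A i) x) \<longlonglongrightarrow> (indicator (\<Union> (range A)) x :: real)" for x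
        unfolding partial by (rule LIMSEQ_indicator_UN)
    qed simp
  qed
qed

lemma L2_imp_approximable:
  assumes f: "f \<in> L2 M"
  shows "L2_approximable M \<F> f"
proof -
  from borel_measurable_implies_sequence_metric[OF L2_borel_measurable[OF f], of 0]
  obtain s where s: "\<And>i. simple_function M (s i)"
      and lim: "\<And>x. x \<in> space M \<Longrightarrow> (\<lambda>i. s i x) \<longlonglongrightarrow> f x"
      and bound: "\<And>i x. x \<in> space M \<Longrightarrow> \<bar>s i x\<bar> \<le> 2 * \<bar>f x\<bar>"
    unfolding dist_real_def diff_0_right by blast
  show ?thesis
  \<comment> \<open>The simple functions satisfy
    \<open>\<bar>s i x\<bar> \<le> 2 * \<bar>f x\<bar>\<close>, so the error is at most
    \<open>3 * \<bar>f x\<bar>\<close>; hence the factor 9.\<close>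
  proof (rule L2_approximable_lim[where s = s and w = "\<lambda>x. 9 * (f x)\<^sup>2"])
    show "integrable M (\<lambda>x. 9 * (f x)\<^sup>2)"
      using L2_integrable_square[OF f] by simp
    show "(f x - s i x)\<^sup>2 \<le> 9 * (f x)\<^sup>2" if "x \<in> space M" for i x
    proof -
      have "\<bar>f x - s i x\<bar> \<le> \<bar>3 * f x\<bar>"
        using bound[OF that, of i] by linarith
      then show ?thesis
        by (simp only: abs_le_square_iff) (simp add: power_mult_distrib)
    qed
    show "L2_approximable M \<F> (s i)" for i
    proof (rule L2_approximable_cong)
      show "L2_approximable M \<F> (\<lambda>x. \<Sum>y\<in>s i ` space M. y * indicator (s i -` {y} \<inter> space M) x)"
        using s[of i] by (intro L2_approximable_sum L2_approximable_cmult L2_approximable_indicator)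
          (auto simp: simple_function_def)
      show "(\<Sum>y\<in>s i ` space M. y * indicator (s i -` {y} \<inter> space M) x) = s i x" if "x \<in> space M" for x
        using simple_function_indicator_representation_banach[OF s that, of i, symmetric]
        by (simp only: real_scaleR_def mult.commute)
    qed
  qed (use f lim in auto)
qed

end

subsection \<open>Clark--Ocone decomposition of the Bernoulli walk\<close>

locale bernoulli_walk =
  fixes p :: "nat \<Rightarrow> real"
  assumes p_bounds: "\<And>k. 0 < p k \<and> p k < 1"
begin

abbreviation P :: "(nat \<Rightarrow> real) measure" where
  "P \<equiv> walk_space p"

sublocale prob_space P
  by (rule prob_space_walk_space) (rule p_bounds)

sublocale filt: sigma_finite_subalgebra P "filt p n" for n
  by (intro finite_measure_subalgebra_is_sigma_finite finite_measure_subalgebra.intro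
      finite_measure_subalgebra_axioms.intro finite_measure_axioms subalgebra_filt)

text \<open>A pointwise version of the conditional expectation given all coordinates except the
  \<open>k\<close>-th.\<close>

definition resample :: "nat \<Rightarrow> ((nat \<Rightarrow> real) \<Rightarrow> real) \<Rightarrow> (nat \<Rightarrow> real) \<Rightarrow> real" where
  "resample k f w = p k * f (w(k := 1)) + (1 - p k) * f (w(k := -1))"

text \<open>The normalized increment \<open>(X\<^sub>k - E[X\<^sub>k]) / sqrt (Var X\<^sub>k)\<close>.\<close>
definition step :: "nat \<Rightarrow> (nat \<Rightarrow> real) \<Rightarrow> real" where
  "step k w = (w k - (2 * p k - 1)) / (2 * sqrt (p k * (1 - p k)))"

lemma variance_pos: "0 < p k * (1 - p k)"
  using p_bounds[of k] by simp

lemma step_upd: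
  "step k (w(k := 1)) = (1 - p k) / sqrt (p k * (1 - p k))"
  "step k (w(k := -1)) = - p k / sqrt (p k * (1 - p k))"
proof -
  have "1 - (2 * p k - 1) = 2 * (1 - p k)" "-1 - (2 * p k - 1) = 2 * (- p k)"
    by simp_all
  then show "step k (w(k := 1)) = (1 - p k) / sqrt (p k * (1 - p k))"
    "step k (w(k := -1)) = - p k / sqrt (p k * (1 - p k))"
    by (simp_all only: step_def fun_upd_same mult_divide_mult_cancel_left_if zero_neq_numeral[symmetric] if_False)
qed

lemma coord_cases:
  assumes "w \<in> space P"
  obtains "w(k := 1) = w" | "w(k := -1) = w"
proof -
  have "w k = -1 \<or> w k = 1"
    using assms by (auto simp: space_walk_space PiE_iff)
  then show thesis
    using that by (metis fun_upd_triv)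
qed

lemma upd_in_space: "w \<in> space P \<Longrightarrow> x \<in> {-1, 1} \<Longrightarrow> w(k := x) \<in> space P"
  by (auto simp: space_walk_space PiE_iff)

text \<open>A function of a two-valued coordinate is affine in it: mean plus slope times normalized
  coordinate. Mean and slope ignore coordinate \<open>k\<close>, so it suffices to check both values
  of that coordinate; a point of the space is one of its own two updates.\<close>

lemma clark_ocone_one_step:
  assumes "w \<in> space P"
  shows "f w = resample k f w + step k w * grad p k f w"
proof -
  have s: "sqrt (p k * (1 - p k)) \<noteq> 0"
    using variance_pos[of k] unfolding real_sqrt_eq_0_iff by linarith
  have grad_upd: "grad p k f (w(k := x)) = grad p k f w" "resample k f (w(k := x)) = resample k f w" for x
    by (simp_all add: grad_def resample_def)
  have up: "f (w(k := 1)) = resample k f (w(k := 1)) + step k (w(k := 1)) * grad p k f (w(k := 1))"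
    unfolding step_upd grad_upd using s by (simp add: resample_def grad_def) (simp add: algebra_simps)
  have down: "f (w(k := -1)) = resample k f (w(k := -1)) + step k (w(k := -1)) * grad p k f (w(k := -1))"
    unfolding step_upd grad_upd using s by (simp add: resample_def grad_def) (simp add: algebra_simps)
  show ?thesis
    by (rule coord_cases[OF assms, of k]) (use up down in metis)+
qed

section \<open>Integrating out a single coordinate\<close>

lemma measurable_upd [measurable]:
  assumes "x \<in> {-1, 1}"
  shows "(\<lambda>w. w(k := x)) \<in> P \<rightarrow>\<^sub>M P"
  unfolding walk_space_def
  by (rule measurable_fun_upd[where J = UNIV])
    (use assms in \<open>auto simp: sign_measure_def space_point_measure\<close>)

text \<open>Overwriting a coordinate by an independent copy preserves a product measure. The library
  fact inserts an index into an index set; here the index already belongs to it.\<close>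

lemma P_eq_distr: "P = distr (sign_measure (p k) \<Otimes>\<^sub>M P) P (\<lambda>(x, w). w(k := x))"
  using distr_pair_PiM_eq_PiM[of UNIV "\<lambda>k. sign_measure (p k)" k] prob_space_sign_measure p_bounds
  by (simp add: walk_space_def)

text \<open>Tonelli for the fresh coordinate. Working with nonnegative extended values first needs
  no integrability, so the integrability of the updated functions can be derived from it.\<close>

lemma nn_integral_resample:
  assumes [measurable]: "f \<in> borel_measurable P"
  shows "(\<integral>\<^sup>+w. f w \<partial>P)
    = (\<integral>\<^sup>+w. ennreal (p k) * f (w(k := 1)) + ennreal (1 - p k) * f (w(k := -1)) \<partial>P)"
proof -
  interpret S: prob_space "sign_measure (p k)"
    using p_bounds by (intro prob_space_sign_measure) auto
  interpret SP: pair_sigma_finite "sign_measure (p k)" P ..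
  have upd [measurable]: "(\<lambda>(x, w). w(k := x)) \<in> sign_measure (p k) \<Otimes>\<^sub>M P \<rightarrow>\<^sub>M P"
    unfolding walk_space_def split_beta by (rule measurable_fun_upd[where J = UNIV]) auto
  have "(\<integral>\<^sup>+w. f w \<partial>P) = (\<integral>\<^sup>+z. f ((snd z)(k := fst z)) \<partial>(sign_measure (p k) \<Otimes>\<^sub>M P))"
    by (subst P_eq_distr[of k], subst nn_integral_distr) (use assms in \<open>auto simp: split_beta\<close>)
  also have "\<dots> = (\<integral>\<^sup>+w. (\<integral>\<^sup>+x. f (w(k := x)) \<partial>sign_measure (p k)) \<partial>P)"
    using measurable_compose[OF upd assms] by (subst SP.nn_integral_snd[symmetric]) (simp_all add: split_beta)
  also have "\<dots> = (\<integral>\<^sup>+w. ennreal (p k) * f (w(k := 1)) + ennreal (1 - p k) * f (w(k := -1)) \<partial>P)"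
    by (simp add: sign_measure_def nn_integral_point_measure_finite add.commute)
  finally show ?thesis .
qed

lemma integrable_upd:
  fixes f :: "(nat \<Rightarrow> real) \<Rightarrow> real"
  assumes f: "integrable P f" and x: "x \<in> {-1, 1}"
  shows "integrable P (\<lambda>w. f (w(k := x)))"
proof -
  have [measurable]: "f \<in> borel_measurable P"
    using f by simp
  \<comment> \<open>\<open>c\<close> is the probability of the value \<open>x\<close>. It is
    positive, so \<open>c * f (w(k := x))\<close> is bounded through one summand of the average and
    \<open>c\<close> can be cancelled afterwards.\<close>
  define c where "c = (if x = 1 then p k else 1 - p k)"
  have c: "c \<noteq> 0" "0 \<le> c"
    using p_bounds[of k] by (auto simp: c_def)
  have "(\<integral>\<^sup>+w. ennreal (norm (c * f (w(k := x)))) \<partial>P)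
      \<le> (\<integral>\<^sup>+w. ennreal (p k) * ennreal (norm (f (w(k := 1))))
          + ennreal (1 - p k) * ennreal (norm (f (w(k := -1)))) \<partial>P)"
    using x p_bounds[of k]
    by (intro nn_integral_mono) (auto simp: c_def abs_mult ennreal_mult)
  also have "\<dots> = (\<integral>\<^sup>+w. ennreal (norm (f w)) \<partial>P)"
    by (rule nn_integral_resample[symmetric]) simp
  also have "\<dots> < \<infinity>"
    using f by (simp add: integrable_iff_bounded)
  finally have "integrable P (\<lambda>w. c * f (w(k := x)))"
    using measurable_compose[OF measurable_upd[OF x, of k] \<open>f \<in> borel_measurable P\<close>]
    by (intro integrableI_bounded) auto
  then show ?thesis
    using c by simp
qed

lemma integrable_resample: "integrable P f \<Longrightarrow> integrable P (resample k f)"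
  unfolding resample_def by (auto intro!: integrable_upd)

lemma integral_resample:
  assumes f: "integrable P f"
  shows "(\<integral>w. resample k f w \<partial>P) = (\<integral>w. f w \<partial>P)"
proof -
  have nonneg: "(\<integral>w. resample k g w \<partial>P) = (\<integral>w. g w \<partial>P)"
    if g: "integrable P g" "\<And>w. 0 \<le> g w" for g
  proof -
    have pos: "0 \<le> resample k g w" for w
      using g(2) p_bounds[of k] by (simp add: resample_def)
    have "ennreal (\<integral>w. resample k g w \<partial>P) = (\<integral>\<^sup>+w. ennreal (resample k g w) \<partial>P)"
      using pos integrable_resample[OF g(1)] by (intro nn_integral_eq_integral[symmetric]) auto
    also have "\<dots> = (\<integral>\<^sup>+w. ennreal (p k) * ennreal (g (w(k := 1)))
        + ennreal (1 - p k) * ennreal (g (w(k := -1))) \<partial>P)"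
      using p_bounds[of k] g(2)
      by (intro nn_integral_cong) (simp add: resample_def ennreal_plus ennreal_mult less_imp_le)
    also have "\<dots> = (\<integral>\<^sup>+w. ennreal (g w) \<partial>P)"
      using g(1) by (intro nn_integral_resample[symmetric]) simp
    also have "\<dots> = ennreal (\<integral>w. g w \<partial>P)"
      using g by (intro nn_integral_eq_integral) auto
    finally show ?thesis
      using g(2) pos by (subst (asm) ennreal_inj) (auto intro!: integral_nonneg_AE)
  qed
  \<comment> \<open>Positive and negative part reduce the signed case to \<open>nonneg\<close>,
    since \<open>resample\<close> is linear.\<close>
  define g h where "g w = max (f w) 0" and "h w = max (- f w) 0" for w
  have gh: "integrable P g" "integrable P h"
    using f unfolding g_def h_def by (intro integrable_max integrable_minus integrable_zero; simp)+
  have f_eq: "f w = g w - h w" for w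
    by (simp add: g_def h_def)
  have "(\<integral>w. resample k f w \<partial>P) = (\<integral>w. resample k g w - resample k h w \<partial>P)"
    by (intro Bochner_Integration.integral_cong) (simp_all add: resample_def f_eq algebra_simps)
  also have "\<dots> = (\<integral>w. resample k g w \<partial>P) - (\<integral>w. resample k h w \<partial>P)"
    by (intro Bochner_Integration.integral_diff integrable_resample gh)
  also have "\<dots> = (\<integral>w. g w \<partial>P) - (\<integral>w. h w \<partial>P)"
    using nonneg[OF gh(1)] nonneg[OF gh(2)] by (simp add: g_def h_def)
  also have "\<dots> = (\<integral>w. f w \<partial>P)"
    unfolding f_eq by (intro Bochner_Integration.integral_diff[symmetric] gh)
  finally show ?thesis .
qed

lemma L2_upd:
  assumes "f \<in> L2 P" "x \<in> {-1, 1}"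
  shows "(\<lambda>w. f (w(k := x))) \<in> L2 P"
  using integrable_upd[OF L2_integrable_square[OF assms(1)] assms(2)]
    measurable_compose[OF measurable_upd[OF assms(2)] L2_borel_measurable[OF assms(1)]]
  by (simp add: L2_def)

lemma L2_grad: "f \<in> L2 P \<Longrightarrow> grad p k f \<in> L2 P"
  unfolding grad_def by (intro L2_cmult L2_diff L2_upd) auto

lemma L2_resample: "f \<in> L2 P \<Longrightarrow> resample k f \<in> L2 P"
  unfolding resample_def by (intro L2_cmult L2_add L2_upd) auto

section \<open>Coordinate updates and the filtration\<close>

lemma filt_generators:
  "{coord j -` A \<inter> space P | j A. int j \<le> n \<and> A \<subseteq> {-1, 1}} \<subseteq> Pow (space P)"
  by auto

lemma space_filt: "space (filt p n) = space P"
  using subalgebra_filt[of p n] by (simp add: subalgebra_def)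

lemma sets_filt:
  "sets (filt p n) = sigma_sets (space P) {coord j -` A \<inter> space P | j A. int j \<le> n \<and> A \<subseteq> {-1, 1}}"
  unfolding filt_def by (rule sets_measure_of[OF filt_generators])

lemma sets_filt_mono: "m \<le> n \<Longrightarrow> sets (filt p m) \<subseteq> sets (filt p n)"
  unfolding sets_filt by (rule sigma_sets_subseteq) force

lemma measurable_filt_mono:
  assumes "m \<le> n" "h \<in> borel_measurable (filt p m)"
  shows "h \<in> borel_measurable (filt p n)"
  using measurable_mono[of borel borel "filt p m" "filt p n"] sets_filt_mono[OF assms(1)] assms(2)
  by (auto simp: space_filt)

lemma step_measurable_filt:
  assumes "int k \<le> n"
  shows "step k \<in> borel_measurable (filt p n)"
proof -
  have "coord k \<in> borel_measurable (filt p n)"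
  proof (rule measurableI)
    fix A :: "real set"
    have "coord k -` A \<inter> space P = coord k -` (A \<inter> {-1, 1}) \<inter> space P"
      by (auto simp: coord_def space_walk_space PiE_iff)
    also have "\<dots> \<in> sets (filt p n)"
      unfolding sets_filt using assms by (intro sigma_sets.Basic) blast
    finally show "coord k -` A \<inter> space (filt p n) \<in> sets (filt p n)"
      by (simp add: space_filt)
  qed simp
  then have "(\<lambda>w. (coord k w - (2 * p k - 1)) / (2 * sqrt (p k * (1 - p k)))) \<in> borel_measurable (filt p n)"
    by measurable
  then show ?thesis
    unfolding step_def coord_def .
qed

text \<open>Fixing coordinate \<open>k\<close> leaves only the earlier coordinates free, which gains
  one stage: a generator at \<open>k\<close> pulls back to the whole space or to the empty set, an
  earlier generator to itself. For \<open>k = 0\<close> the source is the trivial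
  sigma-algebra.\<close>

lemma measurable_upd_filt:
  assumes x: "x \<in> {-1, 1}"
  shows "(\<lambda>w. w(k := x)) \<in> filt p (int k - 1) \<rightarrow>\<^sub>M filt p (int k)"
proof (rule measurable_sigma_sets[OF sets_filt filt_generators])
  show "(\<lambda>w. w(k := x)) \<in> space (filt p (int k - 1)) \<rightarrow> space P"
    using x by (auto simp: space_filt intro!: upd_in_space)
  fix B assume "B \<in> {coord j -` A \<inter> space P | j A. int j \<le> int k \<and> A \<subseteq> {-1, 1}}"
  then obtain j A where B: "B = coord j -` A \<inter> space P" "int j \<le> int k" "A \<subseteq> {-1, 1}"
    by blast
  show "(\<lambda>w. w(k := x)) -` B \<inter> space (filt p (int k - 1)) \<in> sets (filt p (int k - 1))"
  proof (cases "j = k")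
    case True
    then have "(\<lambda>w. w(k := x)) -` B \<inter> space (filt p (int k - 1))
        = (if x \<in> A then space (filt p (int k - 1)) else {})"
      using x by (auto simp: B coord_def space_filt intro!: upd_in_space)
    then show ?thesis by simp
  next
    case False
    then have "(\<lambda>w. w(k := x)) -` B \<inter> space (filt p (int k - 1)) = coord j -` A \<inter> space P"
      using x by (auto simp: B coord_def space_filt intro!: upd_in_space)
    also have "\<dots> \<in> sets (filt p (int k - 1))"
      unfolding sets_filt using B False by (intro sigma_sets.Basic) force
    finally show ?thesis .
  qed
qed

text \<open>The sets that do not notice an update at \<open>k\<close> include every generator with
  index at most \<open>n < k\<close> and are closed under the sigma-algebra operations.\<close>

lemma filt_upd_invariant:
  assumes h: "h \<in> borel_measurable (filt p n)" and k: "n < int k"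
    and w: "w \<in> space P" and x: "x \<in> {-1, 1}"
  shows "h (w(k := x)) = (h w :: real)"
proof -
  have inv: "\<forall>w\<in>space P. w(k := x) \<in> A \<longleftrightarrow> w \<in> A" if "A \<in> sets (filt p n)" for A
    using that unfolding sets_filt
  proof (induction rule: sigma_sets.induct)
    case (Basic A)
    then obtain j B where A: "A = coord j -` B \<inter> space P" "int j \<le> n"
      by blast
    with k have "j \<noteq> k" by auto
    then have "w(k := x) \<in> A \<longleftrightarrow> w \<in> A" if "w \<in> space P" for w
      using upd_in_space[OF that x, of k] that by (simp add: A coord_def)
    then show ?case by blast
  next
    case (Compl A)
    then show ?case
      using upd_in_space[OF _ x] by blast
  qed blast+
  \<comment> \<open>The level set of \<open>h\<close> through \<open>w\<close> lies in the
    sigma-algebra, so it contains the updated point as well.\<close>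
  have "h -` {h w} \<inter> space P \<in> sets (filt p n)"
    using measurable_sets[OF h, of "{h w}"] by (simp add: space_filt)
  from inv[OF this] show ?thesis
    using w by auto
qed

section \<open>Integration by parts\<close>

lemma L2_step_mult:
  assumes "f \<in> L2 P"
  shows "(\<lambda>w. step k w * f w) \<in> L2 P"
proof (rule L2_bounded_mult[OF assms])
  show "step k \<in> borel_measurable P"
    by (rule measurable_from_subalg[OF subalgebra_filt step_measurable_filt[OF order_refl]])
  \<comment> \<open>On the space \<open>step k\<close> takes only two values, with numerators
    \<open>1 - p k\<close> and \<open>- p k\<close> of modulus at most 1.\<close>
  have "\<bar>step k (w(k := x))\<bar> \<le> 1 / sqrt (p k * (1 - p k))" if "x \<in> {-1, 1}" for w x
    using that p_bounds[of k] variance_pos[of k] by (auto simp: step_upd divide_right_mono)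
  then show "\<bar>step k w\<bar> \<le> 1 / sqrt (p k * (1 - p k))" if "w \<in> space P" for w
    using coord_cases[OF that, of k] by (metis insertCI)
qed

text \<open>Average over coordinate \<open>k\<close>, which \<open>h\<close> ignores. Weight times
  value of \<open>step k\<close> is \<open>p k * (1 - p k) / sqrt (p k * (1 - p k))\<close> at 1 and
  its negative at -1, that is plus or minus the factor in \<open>grad\<close>.\<close>

lemma integration_by_parts:
  assumes f: "f \<in> L2 P" and h: "h \<in> L2 P" "h \<in> borel_measurable (filt p (int k - 1))"
  shows "(\<integral>w. f w * (step k w * h w) \<partial>P) = (\<integral>w. grad p k f w * h w \<partial>P)"
proof -
  have s: "sqrt (p k * (1 - p k)) \<noteq> 0" "sqrt (p k * (1 - p k)) * sqrt (p k * (1 - p k)) = p k * (1 - p k)"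
    using variance_pos[of k] less_imp_le[OF variance_pos[of k]]
    unfolding real_sqrt_eq_0_iff real_sqrt_mult_self by linarith+
  have step_h: "(\<lambda>w. step k w * h w) \<in> L2 P"
    by (rule L2_step_mult[OF h(1)])
  have "(\<integral>w. f w * (step k w * h w) \<partial>P) = (\<integral>w. resample k (\<lambda>w. f w * (step k w * h w)) w \<partial>P)"
    by (intro integral_resample[symmetric] L2_integrable_mult f step_h)
  also have "\<dots> = (\<integral>w. grad p k f w * h w \<partial>P)"
  proof (intro Bochner_Integration.integral_cong refl)
    fix w assume "w \<in> space P"
    then have inv: "h (w(k := 1)) = h w" "h (w(k := -1)) = h w"
      using h(2) by (auto intro!: filt_upd_invariant)
    show "resample k (\<lambda>w. f w * (step k w * h w)) w = grad p k f w * h w"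
      unfolding resample_def grad_def step_upd inv using s by (simp add: field_simps)
  qed
  finally show ?thesis .
qed

section \<open>Conditional expectations of gradients and averages\<close>

lemma L2_cond_exp:
  assumes "f \<in> L2 P"
  shows "real_cond_exp P (filt p n) f \<in> L2 P"
proof -
  have "integrable P (\<lambda>w. (real_cond_exp P (filt p n) f w)\<^sup>2)"
    using L2_integrable[OF assms] L2_integrable_square[OF assms] convex_power2
    \<comment> \<open>Conditional Jensen for the square on the whole line; \<open>undefined\<close>
      stands for the endpoints that \<open>UNIV\<close> does not have.\<close>
    by (intro filt.integrable_convex_cond_exp[where I = UNIV and a = undefined and b = undefined]) auto
  then show ?thesis
    by (simp add: L2_def)
qed

lemma integral_mult_cond_exp:
  assumes "h \<in> L2 P" "h \<in> borel_measurable (filt p n)" "f \<in> L2 P"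
  shows "(\<integral>w. h w * real_cond_exp P (filt p n) f w \<partial>P) = (\<integral>w. h w * f w \<partial>P)"
  using assms L2_integrable_mult L2_borel_measurable by (intro filt.real_cond_exp_intg(2)) auto

text \<open>Writing the set integrals as integrals against indicators makes them accessible to
  \<open>integration_by_parts\<close> and \<open>integral_mult_cond_exp\<close>.\<close>

lemma cond_exp_charact_L2:
  assumes f: "f \<in> L2 P" and g: "g \<in> L2 P" "g \<in> borel_measurable (filt p n)"
    and eq: "\<And>A. A \<in> sets (filt p n) \<Longrightarrow> (\<integral>w. f w * indicator A w \<partial>P) = (\<integral>w. g w * indicator A w \<partial>P)"
  shows "AE w in P. real_cond_exp P (filt p n) f w = g w"
proof (rule filt.real_cond_exp_charact)
  show "set_lebesgue_integral P A f = set_lebesgue_integral P A g" if "A \<in> sets (filt p n)" for A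
    using eq[OF that] by (simp add: set_lebesgue_integral_def mult.commute)
qed (use f g L2_integrable in auto)

lemma L2_indicator_filt:
  assumes "A \<in> sets (filt p n)"
  shows "(indicator A :: _ \<Rightarrow> real) \<in> L2 P" "(indicator A :: _ \<Rightarrow> real) \<in> borel_measurable (filt p n)"
proof -
  have "A \<in> sets P"
    using assms subalgebra_filt[of p n] by (auto simp: subalgebra_def)
  then show "(indicator A :: _ \<Rightarrow> real) \<in> L2 P"
    by (intro L2_bounded[where C = 1]) (auto simp: indicator_def)
qed (use assms in simp)

lemma grad_measurable_filt:
  assumes "f \<in> borel_measurable (filt p (int k))"
  shows "grad p k f \<in> borel_measurable (filt p (int k - 1))"
  unfolding grad_def
  by (intro borel_measurable_times borel_measurable_diff borel_measurable_const
      measurable_compose[OF measurable_upd_filt assms]) auto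

lemma resample_measurable_filt:
  assumes "f \<in> borel_measurable (filt p (int k))"
  shows "resample k f \<in> borel_measurable (filt p (int k - 1))"
  unfolding resample_def
  by (intro borel_measurable_times borel_measurable_add borel_measurable_const
      measurable_compose[OF measurable_upd_filt assms]) auto

text \<open>Test against \<open>A\<close> at stage \<open>k - 1\<close>: by duality the gradient
  becomes multiplication by \<open>step k\<close>. As \<open>step k * indicator A\<close> is
  measurable at stage \<open>k\<close>, \<open>g\<close> may be replaced by its conditional
  expectation there, and duality leads back.\<close>

lemma cond_exp_grad:
  assumes g: "g \<in> L2 P"
  shows "AE w in P. real_cond_exp P (filt p (int k - 1)) (grad p k g) w
    = grad p k (real_cond_exp P (filt p (int k)) g) w"
proof (rule cond_exp_charact_L2)
  let ?E = "real_cond_exp P (filt p (int k)) g"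
  fix A assume A: "A \<in> sets (filt p (int k - 1))"
  note ind = L2_indicator_filt[OF A]
  have meas: "(\<lambda>w. step k w * indicator A w) \<in> borel_measurable (filt p (int k))"
    by (intro borel_measurable_times step_measurable_filt measurable_filt_mono[OF _ ind(2)]) auto
  have "(\<integral>w. grad p k g w * indicator A w \<partial>P) = (\<integral>w. (step k w * indicator A w) * g w \<partial>P)"
    using integration_by_parts[OF g ind] by (simp add: mult_ac)
  also have "\<dots> = (\<integral>w. (step k w * indicator A w) * ?E w \<partial>P)"
    by (rule integral_mult_cond_exp[symmetric, OF L2_step_mult[OF ind(1)] meas g])
  also have "\<dots> = (\<integral>w. grad p k ?E w * indicator A w \<partial>P)"
    using integration_by_parts[OF L2_cond_exp[OF g] ind] by (simp add: mult_ac)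
  finally show "(\<integral>w. grad p k g w * indicator A w \<partial>P) = (\<integral>w. grad p k ?E w * indicator A w \<partial>P)" .
qed (intro L2_grad L2_cond_exp g grad_measurable_filt borel_measurable_cond_exp)+

text \<open>The tower property: for a function measurable at stage \<open>k\<close>, averaging over
  coordinate \<open>k\<close> is conditioning on stage \<open>k - 1\<close>.\<close>

lemma cond_exp_resample:
  assumes g: "g \<in> L2 P"
  shows "AE w in P. real_cond_exp P (filt p (int k - 1)) g w
    = resample k (real_cond_exp P (filt p (int k)) g) w"
proof (rule cond_exp_charact_L2)
  let ?E = "real_cond_exp P (filt p (int k)) g"
  fix A assume A: "A \<in> sets (filt p (int k - 1))"
  note ind = L2_indicator_filt[OF A]
  have "(\<integral>w. g w * indicator A w \<partial>P) = (\<integral>w. indicator A w * ?E w \<partial>P)"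
    using integral_mult_cond_exp[OF ind(1) measurable_filt_mono[OF _ ind(2)] g, of "int k"]
    by (simp add: mult.commute)
  also have "\<dots> = (\<integral>w. resample k (\<lambda>w. indicator A w * ?E w) w \<partial>P)"
    by (intro integral_resample[symmetric] L2_integrable_mult ind L2_cond_exp g)
  also have "\<dots> = (\<integral>w. resample k ?E w * indicator A w \<partial>P)"
  proof (intro Bochner_Integration.integral_cong refl)
    fix w assume "w \<in> space P"
    then have "indicator A (w(k := 1)) = (indicator A w :: real)"
      "indicator A (w(k := -1)) = (indicator A w :: real)"
      using ind(2) by (auto intro!: filt_upd_invariant)
    then show "resample k (\<lambda>w. indicator A w * ?E w) w = resample k ?E w * indicator A w"
      by (simp add: resample_def algebra_simps)
  qed
  finally show "(\<integral>w. g w * indicator A w \<partial>P) = (\<integral>w. resample k ?E w * indicator A w \<partial>P)" .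
qed (intro L2_resample L2_cond_exp g resample_measurable_filt borel_measurable_cond_exp)+

text \<open>\<open>clark_ocone_one_step\<close> for the conditional expectation at stage
  \<open>k\<close>, whose mean and slope the two preceding lemmas identify.\<close>

lemma martingale_increment:
  assumes g: "g \<in> L2 P"
  shows "AE w in P. real_cond_exp P (filt p (int k)) g w = real_cond_exp P (filt p (int k - 1)) g w
    + step k w * real_cond_exp P (filt p (int k - 1)) (grad p k g) w"
  using cond_exp_grad[OF g, of k] cond_exp_resample[OF g, of k] AE_space
  by eventually_elim (simp only: clark_ocone_one_step[symmetric])

lemma cond_exp_trivial:
  assumes g: "g \<in> L2 P"
  shows "AE w in P. real_cond_exp P (filt p (-1)) g w = (\<integral>w. g w \<partial>P)"
proof (rule cond_exp_charact_L2[OF g])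
  show "(\<lambda>_. \<integral>w. g w \<partial>P) \<in> L2 P"
    by (intro L2_bounded[where C = "\<bar>\<integral>w. g w \<partial>P\<bar>"]) auto
  fix A assume "A \<in> sets (filt p (-1))"
  then consider "A = {}" | "A = space P"
    by (auto simp: sets_filt_minus_1)
  then show "(\<integral>w. g w * indicator A w \<partial>P) = (\<integral>w. (\<integral>w. g w \<partial>P) * indicator A w \<partial>P)"
  proof cases
    case 2
    have "(\<integral>w. g w * indicator (space P) w \<partial>P) = (\<integral>w. g w \<partial>P)"
      by (intro Bochner_Integration.integral_cong) auto
    then show ?thesis
      by (simp add: 2 prob_space)
  qed simp
qed simp

section \<open>Telescoping and Bessel's inequality\<close>

lemma clark_ocone_partial:
  assumes g: "g \<in> L2 P"
  shows "AE w in P. real_cond_exp P (filt p (int n - 1)) g w = (\<integral>w. g w \<partial>P)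
    + (\<Sum>k<n. step k w * real_cond_exp P (filt p (int k - 1)) (grad p k g) w)"
proof (induction n)
  \<comment> \<open>The empty sum belongs to index -1, where conditioning gives the mean.\<close>
  case 0
  then show ?case
    using cond_exp_trivial[OF g] by simp
next
  case (Suc n)
  from this martingale_increment[OF g, of n] show ?case
    by eventually_elim simp
qed

text \<open>Multiply the telescoped expansion of \<open>g\<close> by \<open>f\<close> and integrate;
  each coefficient is measurable at stage \<open>k - 1\<close>, so integration by parts moves
  \<open>step k\<close> onto \<open>f\<close> as a gradient.\<close>

lemma integral_mult_partial_sum:
  assumes f: "f \<in> L2 P" and g: "g \<in> L2 P"
  shows "(\<Sum>k<n. \<integral>w. real_cond_exp P (filt p (int k - 1)) (grad p k g) w * grad p k f w \<partial>P)
    = (\<integral>w. f w * real_cond_exp P (filt p (int n - 1)) g w \<partial>P) - (\<integral>w. f w \<partial>P) * (\<integral>w. g w \<partial>P)"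
proof -
  let ?u = "\<lambda>k. real_cond_exp P (filt p (int k - 1)) (grad p k g)"
  have u: "?u k \<in> L2 P" "?u k \<in> borel_measurable (filt p (int k - 1))" for k
    by (intro L2_cond_exp L2_grad g borel_measurable_cond_exp)+
  have int: "integrable P (\<lambda>w. f w * (step k w * ?u k w))" for k
    by (intro L2_integrable_mult f L2_step_mult u)
  have "(\<integral>w. f w * real_cond_exp P (filt p (int n - 1)) g w \<partial>P)
      = (\<integral>w. f w * (\<integral>w. g w \<partial>P) + (\<Sum>k<n. f w * (step k w * ?u k w)) \<partial>P)"
  proof (rule integral_cong_AE)
    show "(\<lambda>w. f w * real_cond_exp P (filt p (int n - 1)) g w) \<in> borel_measurable P"
      using L2_integrable_mult[OF f L2_cond_exp[OF g]] by simp
    show "(\<lambda>w. f w * (\<integral>w. g w \<partial>P) + (\<Sum>k<n. f w * (step k w * ?u k w))) \<in> borel_measurable P"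
      using int L2_borel_measurable[OF f] by (intro borel_measurable_add borel_measurable_sum) auto
    show "AE w in P. f w * real_cond_exp P (filt p (int n - 1)) g w
        = f w * (\<integral>w. g w \<partial>P) + (\<Sum>k<n. f w * (step k w * ?u k w))"
      using clark_ocone_partial[OF g, of n]
      by eventually_elim (simp only: distrib_left sum_distrib_left)
  qed
  also have "\<dots> = (\<integral>w. f w \<partial>P) * (\<integral>w. g w \<partial>P) + (\<Sum>k<n. \<integral>w. f w * (step k w * ?u k w) \<partial>P)"
    using int L2_integrable[OF f] by simp
  also have "(\<Sum>k<n. \<integral>w. f w * (step k w * ?u k w) \<partial>P) = (\<Sum>k<n. \<integral>w. ?u k w * grad p k f w \<partial>P)"
    using integration_by_parts[OF f u] by (simp add: mult.commute)
  finally show ?thesis by simp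
qed

text \<open>Pythagoras: the integral of \<open>g\<close> times its projection is the squared norm of
  the projection, and the squared norm of \<open>g\<close> is that plus the squared
  distance.\<close>

lemma integral_square_cond_exp_le:
  assumes g: "g \<in> L2 P"
  shows "(\<integral>w. g w * real_cond_exp P (filt p n) g w \<partial>P) \<le> (\<integral>w. (g w)\<^sup>2 \<partial>P)"
    and "(\<integral>w. (real_cond_exp P (filt p n) g w - g w)\<^sup>2 \<partial>P) \<le> (\<integral>w. (g w)\<^sup>2 \<partial>P)"
proof -
  let ?E = "real_cond_exp P (filt p n) g"
  note E = L2_cond_exp[OF g, of n]
  have eq: "(\<integral>w. (?E w)\<^sup>2 \<partial>P) = (\<integral>w. g w * ?E w \<partial>P)"
    using integral_mult_cond_exp[OF E borel_measurable_cond_exp g] by (simp add: power2_eq_square mult.commute)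
  have "(\<integral>w. (?E w - g w)\<^sup>2 \<partial>P) = (\<integral>w. (?E w)\<^sup>2 + (g w)\<^sup>2 - 2 * (g w * ?E w) \<partial>P)"
    by (simp add: power2_diff mult_ac)
  also have "\<dots> = (\<integral>w. (g w)\<^sup>2 \<partial>P) - (\<integral>w. g w * ?E w \<partial>P)"
    using L2_integrable_square[OF E] L2_integrable_square[OF g] L2_integrable_mult[OF g E] eq by simp
  finally have diff: "(\<integral>w. (?E w - g w)\<^sup>2 \<partial>P) = (\<integral>w. (g w)\<^sup>2 \<partial>P) - (\<integral>w. g w * ?E w \<partial>P)" .
  have "0 \<le> (\<integral>w. (?E w - g w)\<^sup>2 \<partial>P)" "0 \<le> (\<integral>w. (?E w)\<^sup>2 \<partial>P)"
    by simp_all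
  then show "(\<integral>w. g w * ?E w \<partial>P) \<le> (\<integral>w. (g w)\<^sup>2 \<partial>P)" "(\<integral>w. (?E w - g w)\<^sup>2 \<partial>P) \<le> (\<integral>w. (g w)\<^sup>2 \<partial>P)"
    using diff eq by linarith+
qed

text \<open>Conditioning turns each squared coefficient into its product with
  \<open>grad p k g\<close>, so \<open>integral_mult_partial_sum\<close> with \<open>f = g\<close>
  evaluates the sum. The bound involves only the \<open>L2\<close> norm of \<open>g\<close>, not its
  gradient.\<close>

lemma bessel:
  assumes g: "g \<in> L2 P"
  shows "(\<Sum>k<n. \<integral>w. (real_cond_exp P (filt p (int k - 1)) (grad p k g) w)\<^sup>2 \<partial>P) \<le> (\<integral>w. (g w)\<^sup>2 \<partial>P)"
proof -
  have "(\<integral>w. (real_cond_exp P (filt p (int k - 1)) (grad p k g) w)\<^sup>2 \<partial>P)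
      = (\<integral>w. real_cond_exp P (filt p (int k - 1)) (grad p k g) w * grad p k g w \<partial>P)" for k
    using integral_mult_cond_exp[OF L2_cond_exp[OF L2_grad[OF g]] borel_measurable_cond_exp L2_grad[OF g]]
    by (simp add: power2_eq_square)
  then have "(\<Sum>k<n. \<integral>w. (real_cond_exp P (filt p (int k - 1)) (grad p k g) w)\<^sup>2 \<partial>P)
      = (\<integral>w. g w * real_cond_exp P (filt p (int n - 1)) g w \<partial>P) - (\<integral>w. g w \<partial>P) * (\<integral>w. g w \<partial>P)"
    by (simp add: integral_mult_partial_sum[OF g g])
  then show ?thesis
    using integral_square_cond_exp_le(1)[OF g, of "int n - 1"] zero_le_square[of "\<integral>w. g w \<partial>P"] by linarith
qed

section \<open>Weak convergence of the conditional expectations\<close>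

lemma generating_filtration_walk: "generating_filtration P (\<lambda>n. filt p (int n - 1))"
proof (intro generating_filtration.intro generating_filtration_axioms.intro finite_measure_axioms)
  let ?U = "\<Union>n. sets (filt p (int n - 1))"
  have U: "?U \<subseteq> sets P"
    using subalgebra_filt by (auto simp: subalgebra_def)
  show "sets P = sigma_sets (space P) ?U"
  proof (rule antisym)
    show "sigma_sets (space P) ?U \<subseteq> sets P"
      by (rule sets.sigma_sets_subset[OF U])
    have cylinder: "{w \<in> space P. w i \<in> A} \<in> ?U" if "A \<in> sets (sign_measure (p i))" for i A
    proof (rule UN_I)
      have "A \<subseteq> {-1, 1}"
        using that by (simp add: sign_measure_def sets_point_measure)
      \<comment> \<open>Stage \<open>n\<close> uses the coordinates below \<open>n\<close>, so a
        cylinder at \<open>i\<close> first appears at stage \<open>Suc i\<close>.\<close>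
      then have "coord i -` A \<inter> space P \<in> sets (filt p (int (Suc i) - 1))"
        unfolding sets_filt by (intro sigma_sets.Basic) force
      then show "{w \<in> space P. w i \<in> A} \<in> sets (filt p (int (Suc i) - 1))"
        by (simp add: coord_def vimage_def Int_def conj_commute)
    qed simp
    have "sets P = sigma_sets (space P) {{w \<in> space P. w i \<in> A} | i A. i \<in> UNIV \<and> A \<in> sets (sign_measure (p i))}"
      unfolding walk_space_def space_PiM by (rule sets_PiM_single)
    also have "\<dots> \<subseteq> sigma_sets (space P) ?U"
      using cylinder by (intro sigma_sets_subseteq) blast
    finally show "sets P \<subseteq> sigma_sets (space P) ?U" .
  qed
qed (auto simp: subalgebra_filt intro!: sets_filt_mono)

text \<open>
  An \<open>\<F>\<^sub>N\<close>-measurable \<open>h\<close> is orthogonal to \<open>E[g | \<F>\<^sub>n] - g\<close> for \<open>n \<ge> N\<close>, so \<open>f\<close> may be replaced by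
  \<open>f - h\<close>, which is small in \<open>L\<^sup>2\<close>. This avoids any martingale convergence theorem.
\<close>
lemma cond_exp_weakly_tendsto:
  assumes f: "f \<in> L2 P" and g: "g \<in> L2 P"
  shows "(\<lambda>n. \<integral>w. f w * real_cond_exp P (filt p (int n - 1)) g w \<partial>P) \<longlonglongrightarrow> (\<integral>w. f w * g w \<partial>P)"
proof (rule LIMSEQ_I)
  fix e :: real assume e: "0 < e"
  \<comment> \<open>The summand 1 keeps \<open>C\<close> positive even if \<open>g\<close> vanishes
    almost everywhere.\<close>
  define C where "C = (\<integral>w. (g w)\<^sup>2 \<partial>P) + 1"
  have C: "0 < C"
    unfolding C_def by (intro add_nonneg_pos) simp_all
  interpret generating_filtration P "\<lambda>n. filt p (int n - 1)"
    by (rule generating_filtration_walk)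
  have "0 < e\<^sup>2 / C"
    using e C by simp
  then obtain N h where h: "h \<in> L2 P" "h \<in> borel_measurable (filt p (int N - 1))"
    "(\<integral>w. (f w - h w)\<^sup>2 \<partial>P) < e\<^sup>2 / C"
    using L2_imp_approximable[OF f] unfolding L2_approximable_def by blast
  show "\<exists>N. \<forall>n\<ge>N. norm ((\<integral>w. f w * real_cond_exp P (filt p (int n - 1)) g w \<partial>P) - (\<integral>w. f w * g w \<partial>P)) < e"
  proof (intro exI[of _ N] allI impI)
    fix n assume "N \<le> n"
    let ?E = "real_cond_exp P (filt p (int n - 1)) g"
    note E = L2_cond_exp[OF g, of "int n - 1"]
    have hE: "(\<integral>w. h w * ?E w \<partial>P) = (\<integral>w. h w * g w \<partial>P)"
      using \<open>N \<le> n\<close> by (intro integral_mult_cond_exp h(1) g measurable_filt_mono[OF _ h(2)]) simp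
    have "(\<integral>w. f w * ?E w \<partial>P) - (\<integral>w. f w * g w \<partial>P) = (\<integral>w. (f w - h w) * (?E w - g w) \<partial>P)"
      using hE L2_integrable_mult[OF f E] L2_integrable_mult[OF f g]
        L2_integrable_mult[OF h(1) E] L2_integrable_mult[OF h(1) g]
      by (simp add: left_diff_distrib right_diff_distrib)
    also have "norm \<dots> \<le> (\<integral>w. norm ((f w - h w) * (?E w - g w)) \<partial>P)"
      by (rule integral_norm_bound)
    also have "\<dots> \<le> (\<integral>w. C / (2 * e) * (f w - h w)\<^sup>2 + e / (2 * C) * (?E w - g w)\<^sup>2 \<partial>P)"
    proof (rule integral_mono)
      show "integrable P (\<lambda>w. norm ((f w - h w) * (?E w - g w)))"
        by (rule integrable_norm[OF L2_integrable_mult[OF L2_diff[OF f h(1)] L2_diff[OF E g]]])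
      show "integrable P (\<lambda>w. C / (2 * e) * (f w - h w)\<^sup>2 + e / (2 * C) * (?E w - g w)\<^sup>2)"
        by (intro Bochner_Integration.integrable_add integrable_mult_right L2_integrable_square L2_diff f h(1) E g)
      show "norm ((f w - h w) * (?E w - g w)) \<le> C / (2 * e) * (f w - h w)\<^sup>2 + e / (2 * C) * (?E w - g w)\<^sup>2" for w
        using weighted_young[OF C e] by simp
    qed
    also have "\<dots> = C / (2 * e) * (\<integral>w. (f w - h w)\<^sup>2 \<partial>P) + e / (2 * C) * (\<integral>w. (?E w - g w)\<^sup>2 \<partial>P)"
      using L2_integrable_square[OF L2_diff[OF f h(1)]] L2_integrable_square[OF L2_diff[OF E g]] by simp
    \<comment> \<open>Each of the two terms on the right equals \<open>e / 2\<close>.\<close>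
    also have "\<dots> < C / (2 * e) * (e\<^sup>2 / C) + e / (2 * C) * C"
    proof (rule add_less_le_mono)
      show "C / (2 * e) * (\<integral>w. (f w - h w)\<^sup>2 \<partial>P) < C / (2 * e) * (e\<^sup>2 / C)"
        by (rule mult_strict_left_mono[OF h(3)]) (use e C in simp)
      show "e / (2 * C) * (\<integral>w. (?E w - g w)\<^sup>2 \<partial>P) \<le> e / (2 * C) * C"
      proof (rule mult_left_mono)
        show "(\<integral>w. (?E w - g w)\<^sup>2 \<partial>P) \<le> C"
          using integral_square_cond_exp_le(2)[OF g, of "int n - 1"] unfolding C_def by linarith
      qed (use e C in simp)
    qed
    also have "\<dots> = e"
      using e C by (simp add: power2_eq_square)
    finally show "norm ((\<integral>w. f w * ?E w \<partial>P) - (\<integral>w. f w * g w \<partial>P)) < e" .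
  qed
qed

section \<open>Passage to the infinite series\<close>

lemma covariance_identity:
  assumes f: "f \<in> L2 P" and g: "g \<in> L2 P"
    and Df: "(\<integral>\<^sup>+w. grad_norm_sq p f w \<partial>P) < \<infinity>"
  defines "a \<equiv> \<lambda>k w. real_cond_exp P (filt p (int k - 1)) (grad p k g) w * grad p k f w"
  shows "AE w in P. summable (\<lambda>k. a k w)"
    and "integrable P (\<lambda>w. \<Sum>k. a k w)"
    and "cov P f g = (\<integral>w. (\<Sum>k. a k w) \<partial>P)"
proof -
  let ?u = "\<lambda>k. real_cond_exp P (filt p (int k - 1)) (grad p k g)"
  have u: "?u k \<in> L2 P" for k
    by (intro L2_cond_exp L2_grad g)
  have D: "grad p k f \<in> L2 P" for k
    by (rule L2_grad[OF f])
  note [measurable] = L2_borel_measurable[OF u] L2_borel_measurable[OF D]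
  have int_a: "integrable P (a k)" for k
    unfolding a_def by (intro L2_integrable_mult u D)
  \<comment> \<open>By Tonelli the finiteness of the expected squared gradient norm is summability
    of the individual expectations.\<close>
  have "(\<Sum>k. ennreal (\<integral>w. (grad p k f w)\<^sup>2 \<partial>P)) = (\<Sum>k. \<integral>\<^sup>+w. ennreal ((grad p k f w)\<^sup>2) \<partial>P)"
    using L2_integrable_square[OF D] by (simp add: nn_integral_eq_integral)
  also have "\<dots> = (\<integral>\<^sup>+w. grad_norm_sq p f w \<partial>P)"
    unfolding grad_norm_sq_def by (rule nn_integral_suminf[symmetric]) simp
  finally have sum_D: "summable (\<lambda>k. \<integral>w. (grad p k f w)\<^sup>2 \<partial>P)"
    using Df by (intro summable_suminf_not_top) auto
  have sum_u: "summable (\<lambda>k. \<integral>w. (?u k w)\<^sup>2 \<partial>P)"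
    using bessel[OF g] by (intro summableI_nonneg_bounded[where x = "\<integral>w. (g w)\<^sup>2 \<partial>P"]) auto
  have le: "(\<integral>w. norm (a k w) \<partial>P) \<le> (\<integral>w. (?u k w)\<^sup>2 \<partial>P) + (\<integral>w. (grad p k f w)\<^sup>2 \<partial>P)" for k
  proof -
    have "(\<integral>w. norm (a k w) \<partial>P) \<le> (\<integral>w. (?u k w)\<^sup>2 + (grad p k f w)\<^sup>2 \<partial>P)"
      using int_a L2_integrable_square[OF u] L2_integrable_square[OF D]
      by (intro integral_mono Bochner_Integration.integrable_add integrable_norm)
        (simp_all add: a_def abs_mult_le_sum_squares)
    also have "\<dots> = (\<integral>w. (?u k w)\<^sup>2 \<partial>P) + (\<integral>w. (grad p k f w)\<^sup>2 \<partial>P)"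
      by (intro Bochner_Integration.integral_add L2_integrable_square u D)
    finally show ?thesis .
  qed
  have sum_norm: "summable (\<lambda>k. \<integral>w. norm (a k w) \<partial>P)"
    using le by (intro summable_comparison_test'[OF summable_add[OF sum_u sum_D], of 0]) auto
  \<comment> \<open>The sum of the absolute values has finite integral, hence is finite almost
    everywhere; with \<open>sum_norm\<close> this licenses exchanging series and integral.\<close>
  have AE_norm: "AE w in P. summable (\<lambda>k. norm (a k w))"
  proof -
    have "(\<integral>\<^sup>+w. (\<Sum>k. ennreal (norm (a k w))) \<partial>P) = (\<Sum>k. ennreal (\<integral>w. norm (a k w) \<partial>P))"
      using int_a by (subst nn_integral_suminf) (auto simp: nn_integral_eq_integral)
    also have "\<dots> \<noteq> \<infinity>"
      using sum_norm by (simp add: ennreal_suminf_neq_top)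
    finally have "AE w in P. (\<Sum>k. ennreal (norm (a k w))) \<noteq> \<infinity>"
      using int_a by (intro nn_integral_PInf_AE) auto
    then show ?thesis
      by eventually_elim (auto intro: summable_suminf_not_top)
  qed
  then show "AE w in P. summable (\<lambda>k. a k w)"
    by eventually_elim (rule summable_norm_cancel)
  show "integrable P (\<lambda>w. \<Sum>k. a k w)"
    by (rule integrable_suminf[OF int_a AE_norm sum_norm])
  have "(\<lambda>n. \<Sum>k<n. \<integral>w. a k w \<partial>P) \<longlonglongrightarrow> (\<integral>w. (\<Sum>k. a k w) \<partial>P)"
    using sums_integral[OF int_a AE_norm sum_norm] by (simp add: sums_def)
  \<comment> \<open>The partial sums have a closed form, whose limit comes from weak convergence;
    uniqueness of limits then identifies the two expressions.\<close>
  moreover have "(\<lambda>n. \<Sum>k<n. \<integral>w. a k w \<partial>P) \<longlonglongrightarrow> cov P f g"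
    unfolding a_def integral_mult_partial_sum[OF f g] cov_def
    by (intro tendsto_diff cond_exp_weakly_tendsto[OF f g] tendsto_const)
  ultimately show "cov P f g = (\<integral>w. (\<Sum>k. a k w) \<partial>P)"
    using LIMSEQ_unique by blast
qed

end

text \<open>Integral, series and conditional expectation are total functions here. The integrability
  and summability conjuncts ensure that the final identity is about genuine values.\<close>

theorem proposition11p1:
  fixes p :: "nat \<Rightarrow> real" and F G :: "(nat \<Rightarrow> real) \<Rightarrow> real"
  assumes "\<And>k. 0 < p k \<and> p k < 1"
    and "F \<in> L2 (walk_space p)" and "G \<in> L2 (walk_space p)"
    and "(\<integral>\<^sup>+\<omega>. grad_norm_sq p F \<omega> \<partial>walk_space p) < \<infinity>"
  shows "(\<forall>k. integrable (walk_space p) (grad p k G))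
    \<and> (AE \<omega> in walk_space p. summable (\<lambda>k.
          real_cond_exp (walk_space p) (filt p (int k - 1)) (grad p k G) \<omega> * grad p k F \<omega>))
    \<and> integrable (walk_space p) (\<lambda>\<omega>. \<Sum>k.
          real_cond_exp (walk_space p) (filt p (int k - 1)) (grad p k G) \<omega> * grad p k F \<omega>)
    \<and> cov (walk_space p) F G = (LINT \<omega>|walk_space p. (\<Sum>k.
          real_cond_exp (walk_space p) (filt p (int k - 1)) (grad p k G) \<omega> * grad p k F \<omega>))"
proof -
  interpret bernoulli_walk p
    by unfold_locales (rule assms(1))
  show ?thesis
    using covariance_identity[OF assms(2-4)] L2_integrable[OF L2_grad[OF assms(3)]] by blast
qed

end
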